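(* Let $X$ be a rank-1 $\mathbb{F}_2$-Grassmannian complex, and let $Y=\mathrm{Cay}(\mathrm{span}\,X(0),\beta(X))$ be the associated rank-2 Cayley simplicial complex. There is a natural isomorphism (of $\mathbb{F}_2$-vector spaces) $$H_1(Y)/(S_1(Y)+B_1(Y))\;\cong\;\ker G_X^\top/\mathrm{im}\,H_X^\top,$$ where the left-hand side denotes the quotient of $H_1(Y)=Z_1(Y)/B_1(Y)$ by the image of the swap cycles $S_1(Y)$, i.e. $Z_1(Y)/(S_1(Y)+B_1(Y))$.
   Context: An $\mathbb{F}_2$-Grassmannian complex $X$ in ambient space $\mathbb{F}_2^k$ is a collection of linear subspaces of $\mathbb{F}_2^k$ closed under taking subspaces; $X(i)$ is the set of $(i+1)$-dimensional elements; it has rank 1 if every element is contained in a 2-dimensional element and there are no elements of larger dimension. A vertex $\{0,v\}\in X(0)$ is identified with the nonzero vector $v$. $G_X\in\mathbb{F}_2^{X(0)\times k}$ is the matrix whose row indexed by $x_0\in X(0)$ is the vector $x_0$. $H_X\in\mathbb{F}_2^{X(1)\times X(0)}$ is the matrix whose row indexed by $x_1\in X(1)$ is the indicator vector of the three nonzero elements of $x_1$. One has $H_XG_X=0$, so $\mathrm{im}\,H_X^\top\subseteq\ker G_X^\top\subseteq\mathbb{F}_2^{X(0)}$. $Y=\mathrm{Cay}(\mathrm{span}\,X(0),\beta(X))$ is the simplicial complex with vertex set $A=\mathrm{span}\,X(0)$, edges $\{v,v+x_0\}$ for $v\in A$, $x_0\in X(0)$, and triangles $\{v,v+x_0,v+x_0'\}$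 for $v\in A$ and distinct $x_0,x_0'\in X(0)$ whose span is in $X(1)$. All chains have $\mathbb{F}_2$-coefficients: $Z_1(Y)=\ker\partial_1$ and $B_1(Y)=\mathrm{im}\,\partial_2$ are the simplicial 1-cycles and 1-boundaries, $H_1(Y)=Z_1(Y)/B_1(Y)$. The swap cycles $S_1(Y)\subseteq Z_1(Y)$ are the span of all 1-cycles $$\mathbf 1_{\{v,v+x_0\}}+\mathbf 1_{\{v+x_0,v+x_0+x_0'\}}+\mathbf 1_{\{v+x_0',v+x_0+x_0'\}}+\mathbf 1_{\{v,v+x_0'\}},\qquad v\in A,\ x_0,x_0'\in X(0).$$ *)

theory Defs
  imports
    "HOL-Analysis.Analysis"
    "HOL-Library.Z2"
    "HOL-Library.Set_Algebras"
    "HOL-Library.Function_Algebras"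
begin

text \<open>
  \<^typ>\<open>bit\<close> is the field with two elements. With this instance \<^typ>\<open>bit ^ 'k\<close> is a finite type
  for finite \<open>'k\<close>, so that all sums below over sets of vectors, subspaces or simplices are
  finite sums.
\<close>

instance bit :: finite
proof
  have "(UNIV :: bit set) = {0, 1}"
    by (auto intro: bit.exhaust)
  then show "finite (UNIV :: bit set)"
    by (metis finite.emptyI finite.insertI)
qed


subsection \<open>Coordinate spaces, quotients and isomorphisms\<close>

text \<open>
  Addition of functions is pointwise (from \<^theory>\<open>HOL-Library.Function_Algebras\<close>); this is the
  matching scalar multiplication.
\<close>

definition fscale :: "'f::field \<Rightarrow> ('a \<Rightarrow> 'f) \<Rightarrow> 'a \<Rightarrow> 'f" where
  "fscale c f = (\<lambda>x. c * f x)"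

interpretation fspace: vector_space fscale
  by unfold_locales (simp_all add: fscale_def fun_eq_iff algebra_simps)

text \<open>The coordinate space with index set \<open>I\<close>: functions vanishing off \<open>I\<close>.\<close>

definition coord_space :: "'a set \<Rightarrow> ('a \<Rightarrow> bit) set" where
  "coord_space I = {f. \<forall>x. x \<notin> I \<longrightarrow> f x = 0}"

text \<open>
  The quotient \<open>V/W\<close> is the set of cosets \<open>v +o W\<close> with \<open>v \<in> V\<close>. Cosets are added by the
  elementwise sum of sets from \<^theory>\<open>HOL-Library.Set_Algebras\<close>. They are scaled representative by
  representative, and \<open>W\<close> is added again, since scaling the elements by \<open>0\<close> alone would give
  \<open>{0}\<close> and not the zero coset \<open>W\<close>. As only \<open>+\<close> and a scaling are used, the construction can be
  iterated to form a quotient of a quotient.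
\<close>

definition quotient_space :: "'a::plus set \<Rightarrow> 'a set \<Rightarrow> 'a set set" where
  "quotient_space V W = (\<lambda>v. v +o W) ` V"

definition quotient_scale :: "('f \<Rightarrow> 'a::plus \<Rightarrow> 'a) \<Rightarrow> 'a set \<Rightarrow> 'f \<Rightarrow> 'a set \<Rightarrow> 'a set" where
  "quotient_scale s W c C = (\<Union>v\<in>C. s c v +o W)"

lemma (in vector_space) quotient_operations:
  assumes "subspace W"
  shows "(v +o W) + (w +o W) = (v + w) +o W"
    and "quotient_scale scale W c (v +o W) = scale c v +o W"
proof -
  have W: "W + W = W"
  proof
    show "W + W \<subseteq> W"
      using subspace_add[OF assms] by (auto elim!: set_plus_elim)
    show "W \<subseteq> W + W"
      using subspace_0[OF assms] by (rule set_zero_plus2)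
  qed
  then show "(v +o W) + (w +o W) = (v + w) +o W"
    by (simp add: set_plus_rearrange)
  have "scale c u +o W = scale c v +o W" if "u \<in> v +o W" for u
  proof -
    obtain w where w: "w \<in> W" "u = v + w"
      using \<open>u \<in> v +o W\<close> by (auto simp: elt_set_plus_def)
    have "scale c w +o W = W"
    proof
      show "scale c w +o W \<subseteq> W"
        using w assms by (auto simp: elt_set_plus_def subspace_add subspace_scale)
      show "W \<subseteq> scale c w +o W"
        by (meson assms set_minus_plus subsetI subspace_diff subspace_scale w(1))
    qed
    then show ?thesis
      using w by (metis scale_right_distrib set_plus_rearrange2)
  qed
  moreover have "v \<in> v +o W"
    using set_plus_intro2[OF subspace_0[OF assms], of v] by simp
  ultimately show "quotient_scale scale W c (v +o W) = scale c v +o W"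
    unfolding quotient_scale_def by blast
qed

definition linear_iso_betw ::
  "('f \<Rightarrow> 'a::plus \<Rightarrow> 'a) \<Rightarrow> 'a set \<Rightarrow> ('f \<Rightarrow> 'b::plus \<Rightarrow> 'b) \<Rightarrow> 'b set \<Rightarrow> ('a \<Rightarrow> 'b) \<Rightarrow> bool" where
  "linear_iso_betw s V t U \<phi> \<longleftrightarrow>
     bij_betw \<phi> V U \<and>
     (\<forall>v\<in>V. \<forall>w\<in>V. \<phi> (v + w) = \<phi> v + \<phi> w) \<and>
     (\<forall>c. \<forall>v\<in>V. \<phi> (s c v) = t c (\<phi> v))"


subsection \<open>Simplicial chains over the field with two elements\<close>

text \<open>
  A simplicial complex is a set of nonempty finite sets. The boundary of \<open>c\<close> takes at an
  \<open>(n-1)\<close>-dimensional simplex the sum of the values of \<open>c\<close> over the \<open>n\<close>-dimensional simplices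
  having it as a face.
\<close>

definition simplices :: "'v set set \<Rightarrow> nat \<Rightarrow> 'v set set" where
  "simplices K n = {\<sigma> \<in> K. finite \<sigma> \<and> card \<sigma> = n + 1}"

definition chains :: "'v set set \<Rightarrow> nat \<Rightarrow> ('v set \<Rightarrow> bit) set" where
  "chains K n = coord_space (simplices K n)"

definition boundary :: "'v set set \<Rightarrow> nat \<Rightarrow> ('v set \<Rightarrow> bit) \<Rightarrow> 'v set \<Rightarrow> bit" where
  "boundary K n c = (\<lambda>\<tau>. if \<tau> \<in> K \<and> finite \<tau> \<and> card \<tau> = n
                         then \<Sum>\<sigma> | \<sigma> \<in> simplices K n \<and> \<tau> \<subseteq> \<sigma>. c \<sigma> else 0)"

definition cycles :: "'v set set \<Rightarrow> nat \<Rightarrow> ('v set \<Rightarrow> bit) set" where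
  "cycles K n = {c \<in> chains K n. boundary K n c = 0}"

definition boundaries :: "'v set set \<Rightarrow> nat \<Rightarrow> ('v set \<Rightarrow> bit) set" where
  "boundaries K n = boundary K (n + 1) ` chains K (n + 1)"

definition homology :: "'v set set \<Rightarrow> nat \<Rightarrow> ('v set \<Rightarrow> bit) set set" where
  "homology K n = quotient_space (cycles K n) (boundaries K n)"


subsection \<open>Grassmannian complexes\<close>

definition grassmannian_complex :: "(bit ^ 'k::finite) set set \<Rightarrow> bool" where
  "grassmannian_complex X \<longleftrightarrow>
     (\<forall>U\<in>X. vec.subspace U) \<and> (\<forall>U\<in>X. \<forall>W. vec.subspace W \<and> W \<subseteq> U \<longrightarrow> W \<in> X)"

definition gfaces :: "(bit ^ 'k::finite) set set \<Rightarrow> nat \<Rightarrow> (bit ^ 'k) set set" where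
  "gfaces X i = {U \<in> X. vec.dim U = i + 1}"

definition has_rank :: "(bit ^ 'k::finite) set set \<Rightarrow> nat \<Rightarrow> bool" where
  "has_rank X r \<longleftrightarrow> (\<forall>U\<in>X. \<exists>W\<in>gfaces X r. U \<subseteq> W) \<and> (\<forall>U\<in>X. vec.dim U \<le> r + 1)"

text \<open>The elements \<open>{0, v}\<close> of \<open>gfaces X 0\<close>, identified with the nonzero vectors \<open>v\<close>.\<close>

definition points :: "(bit ^ 'k::finite) set set \<Rightarrow> (bit ^ 'k) set" where
  "points X = {v. v \<noteq> 0 \<and> {0, v} \<in> gfaces X 0}"

text \<open>
  Matrices are functions of a row index and a column index. The row indices of \<open>G_matrix\<close> range
  over \<open>points X\<close>; those of \<open>H_matrix\<close> range over \<open>gfaces X 1\<close> and its column indices over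
  \<open>points X\<close>.
\<close>

definition G_matrix :: "bit ^ 'k::finite \<Rightarrow> 'k \<Rightarrow> bit" where
  "G_matrix x j = x $ j"

definition H_matrix :: "(bit ^ 'k::finite) set \<Rightarrow> bit ^ 'k \<Rightarrow> bit" where
  "H_matrix U x = indicator (U - {0}) x"

text \<open>The product of the transpose of \<open>M\<close>, a matrix with rows indexed by \<open>R\<close>, with \<open>y\<close>.\<close>

definition transpose_mult :: "'r set \<Rightarrow> ('r \<Rightarrow> 'c \<Rightarrow> bit) \<Rightarrow> ('r \<Rightarrow> bit) \<Rightarrow> 'c \<Rightarrow> bit" where
  "transpose_mult R M y = (\<lambda>j. \<Sum>i\<in>R. M i j * y i)"

definition ker_G_transpose :: "(bit ^ 'k::finite) set set \<Rightarrow> (bit ^ 'k \<Rightarrow> bit) set" where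
  "ker_G_transpose X = {y \<in> coord_space (points X). transpose_mult (points X) G_matrix y = 0}"

definition im_H_transpose :: "(bit ^ 'k::finite) set set \<Rightarrow> (bit ^ 'k \<Rightarrow> bit) set" where
  "im_H_transpose X = transpose_mult (gfaces X 1) H_matrix ` coord_space (gfaces X 1)"


subsection \<open>The Cayley complex and its swap cycles\<close>

definition cayley_vertices :: "(bit ^ 'k::finite) set set \<Rightarrow> (bit ^ 'k) set" where
  "cayley_vertices X = vec.span (points X)"

definition cayley_complex :: "(bit ^ 'k::finite) set set \<Rightarrow> (bit ^ 'k) set set" where
  "cayley_complex X =
     {{v} | v. v \<in> cayley_vertices X} \<union>
     {{v, v + x} | v x. v \<in> cayley_vertices X \<and> x \<in> points X} \<union>
     {{v, v + x, v + x'} | v x x'. v \<in> cayley_vertices X \<and> x \<in> points X \<and> x' \<in> points X \<and>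
        x \<noteq> x' \<and> vec.span {x, x'} \<in> gfaces X 1}"

definition swap_cycle :: "bit ^ 'k::finite \<Rightarrow> bit ^ 'k \<Rightarrow> bit ^ 'k \<Rightarrow> (bit ^ 'k) set \<Rightarrow> bit" where
  "swap_cycle v x x' =
     indicator {{v, v + x}} + indicator {{v + x, v + x + x'}} +
     indicator {{v + x', v + x + x'}} + indicator {{v, v + x'}}"

definition swap_cycles :: "(bit ^ 'k::finite) set set \<Rightarrow> ((bit ^ 'k) set \<Rightarrow> bit) set" where
  "swap_cycles X = fspace.span
     {swap_cycle v x x' | v x x'. v \<in> cayley_vertices X \<and> x \<in> points X \<and> x' \<in> points X}"

text \<open>The image of the swap cycles in the first homology space.\<close>

definition swap_classes :: "(bit ^ 'k::finite) set set \<Rightarrow> ((bit ^ 'k) set \<Rightarrow> bit) set set" where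
  "swap_classes X = (\<lambda>s. s +o boundaries (cayley_complex X) 1) ` swap_cycles X"

text \<open>The linear map on 1-chains sending each edge \<open>{v, v + x}\<close> to its generator \<open>x\<close>.\<close>

definition edge_label_map ::
  "(bit ^ 'k::finite) set set \<Rightarrow> ((bit ^ 'k) set \<Rightarrow> bit) \<Rightarrow> bit ^ 'k \<Rightarrow> bit" where
  "edge_label_map X z =
     (\<lambda>x. if x \<in> points X then \<Sum>e\<in>{{v, v + x} | v. v \<in> cayley_vertices X}. z e else 0)"

end

theory Submission
  imports Defs
begin

text \<open>
  The edge label map sends cycles into the kernel of \<open>G\<close> because the label of an edge is the sum of
  its endpoints; it kills swap cycles and maps the boundary of a triangle to a row of \<open>H\<close>. So the
  only real point is that a cycle \<open>z\<close> without labels is a sum of swap cycles. Modulo swap cycles, a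
  walk from \<open>0\<close> depends only on the parity \<open>y\<close> of its use of each generator; call it \<open>P y\<close>. Then \<open>P\<close>
  satisfies \<open>P (y + k) = P y + P k\<close> for \<open>k\<close> in the kernel of \<open>G\<close>, since the walk of \<open>k\<close> returns to \<open>0\<close>.
  For a linear combination of edges, choosing for each vertex a walk from \<open>0\<close> to it and using that \<open>P\<close>
  is additive on the kernel yields \<open>z = P (label z)\<close>.
\<close>

text \<open>
  The pointwise rules are removed because they fire under the eta-expanded terms that
  resolution produces and turn sums of functions into abstractions.
\<close>

declare add_bit_eq_xor [simp del] mult_bit_eq_and [simp del]
  plus_fun_apply [simp del] zero_fun_apply [simp del]

lemmas pointwise = plus_fun_apply zero_fun_apply

subsection \<open>Vector spaces over the field with two elements\<close>

lemma bit_vec_add_self [simp]: "(x :: bit ^ 'k) + x = 0"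
  by (simp add: vec_eq_iff)

lemma bit_vec_add_add_self [simp]: "(x :: bit ^ 'k) + (x + y) = y"
  by (simp add: add.assoc [symmetric])

lemma bit_vec_diff [simp]: "(x :: bit ^ 'k) - y = x + y"
  by (simp add: vec_eq_iff)

lemma bit_vec_add_eq_0_iff: "(x :: bit ^ 'k) + y = 0 \<longleftrightarrow> x = y"
  by (metis bit_vec_diff right_minus_eq)

lemma bit_fun_add_self [simp]: "(f :: 'a \<Rightarrow> bit) + f = 0"
  by (simp add: fun_eq_iff pointwise)

lemma bit_fun_add_add_self [simp]: "(f :: 'a \<Rightarrow> bit) + (f + g) = g"
  by (simp add: fun_eq_iff pointwise add.assoc [symmetric])

lemma bit_fun_diff [simp]: "(f :: 'a \<Rightarrow> bit) - g = f + g"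
  by (simp add: fun_eq_iff pointwise)

lemma fscale_bit: "fscale (c :: bit) f = (if c = 1 then f else 0)"
  by (cases c) (simp_all add: fscale_def fun_eq_iff pointwise)

lemma subspace_bit_funI:
  assumes "(0 :: 'a \<Rightarrow> bit) \<in> S" "\<And>f g. f \<in> S \<Longrightarrow> g \<in> S \<Longrightarrow> f + g \<in> S"
  shows "fspace.subspace S"
  using assms unfolding fspace.subspace_def by (simp add: fscale_bit)

lemma subspace_coord_space: "fspace.subspace (coord_space I)"
  by (rule subspace_bit_funI) (simp_all add: coord_space_def pointwise)

lemma indicator_in_coord_space: "i \<in> I \<Longrightarrow> indicator {i} \<in> coord_space I"
  by (auto simp: coord_space_def indicator_def)

text \<open>Induction on the support: where \<open>f i = 1\<close>, adding
  \<open>indicator {i}\<close> deletes \<open>i\<close> from the support. No coefficients appear, so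
  an additive claim about chains reduces to single simplices.\<close>

lemma coord_space_induct [consumes 2, case_names zero add]:
  assumes "finite I" "f \<in> coord_space I"
    and "P 0" "\<And>f i. f \<in> coord_space I \<Longrightarrow> i \<in> I \<Longrightarrow> P f \<Longrightarrow> P (f + indicator {i})"
  shows "P f"
proof -
  have "f \<in> coord_space I \<and> P f" if "finite J" "J \<subseteq> I" "{x. f x \<noteq> 0} = J" for J f
    using that
  proof (induction J arbitrary: f)
    case empty
    then have "f = 0" by (auto simp: fun_eq_iff pointwise)
    moreover have "(0 :: 'a \<Rightarrow> bit) \<in> coord_space I" by (simp add: coord_space_def pointwise)
    ultimately show ?case using assms(3) by metis
  next
    case (insert i J)
    let ?g = "f + indicator {i}"
    have "f i = 1" using insert.prems by auto
    then have "{x. ?g x \<noteq> 0} = J"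
      using insert.hyps(2) insert.prems by (auto simp: pointwise indicator_def set_eq_iff split: if_splits)
    then have "?g \<in> coord_space I \<and> P ?g" using insert by blast
    then have "P (?g + indicator {i})" using assms(4) insert.prems by blast
    moreover have "?g + indicator {i} = f" by (simp add: add.assoc)
    ultimately show ?case using insert.prems by (auto simp: coord_space_def)
  qed
  moreover have "{x. f x \<noteq> 0} \<subseteq> I" using assms(2) by (auto simp: coord_space_def)
  ultimately show ?thesis using assms(1) finite_subset by blast
qed

text \<open>The only scalars are 0 and 1, so a span is exhausted by adding generators one at a
  time.\<close>

lemma bit_span_induct [consumes 1, case_names zero add]:
  assumes "f \<in> fspace.span S"
    and "P 0" "\<And>f g. f \<in> fspace.span S \<Longrightarrow> g \<in> S \<Longrightarrow> P f \<Longrightarrow> P (f + g)"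
  shows "P (f :: 'a \<Rightarrow> bit)"
proof -
  have "f \<in> fspace.span S \<and> P f"
    using assms(1)
  proof (induction rule: fspace.span_induct_alt)
    case base
    show ?case using assms(2) fspace.span_zero by blast
  next
    case (step c x y)
    have "fscale c x + y = (if c = 1 then y + x else y)"
      by (simp add: fscale_bit add.commute)
    moreover have "y + x \<in> fspace.span S \<and> P (y + x)"
      using step assms(3) fspace.span_add fspace.span_base by metis
    ultimately show ?case using step by presburger
  qed
  then show ?thesis by blast
qed


subsection \<open>Isomorphisms of quotients\<close>

text \<open>The equivalence of \<open>q v = q w\<close> and \<open>g v = g w\<close> lets
  \<open>g\<close> descend along \<open>q\<close> to a well-defined injective map. As
  \<open>q\<close> is arbitrary, this serves both the quotient of a quotient and the quotient by a
  sum.\<close>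

lemma linear_iso_betw_induced:
  assumes "\<And>v w. v \<in> V \<Longrightarrow> w \<in> V \<Longrightarrow> v + w \<in> V"
    and "\<And>c v. v \<in> V \<Longrightarrow> s c v \<in> V"
    and "\<And>v w. v \<in> V \<Longrightarrow> w \<in> V \<Longrightarrow> q v + q w = q (v + w)"
    and "\<And>c v. v \<in> V \<Longrightarrow> sq c (q v) = q (s c v)"
    and "\<And>v w. v \<in> V \<Longrightarrow> w \<in> V \<Longrightarrow> g v + g w = g (v + w)"
    and "\<And>c v. v \<in> V \<Longrightarrow> sg c (g v) = g (s c v)"
    and "\<And>v w. v \<in> V \<Longrightarrow> w \<in> V \<Longrightarrow> q v = q w \<longleftrightarrow> g v = g w"
  shows "\<exists>\<phi>. linear_iso_betw sq (q ` V) sg (g ` V) \<phi> \<and> (\<forall>v\<in>V. \<phi> (q v) = g v)"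
proof -
  define \<phi> where "\<phi> = (\<lambda>C. g (inv_into V q C))"
  have \<phi>: "\<phi> (q v) = g v" if "v \<in> V" for v
    unfolding \<phi>_def using assms(7) that
    by (metis f_inv_into_f image_eqI inv_into_into)
  have "bij_betw \<phi> (q ` V) (g ` V)"
    unfolding bij_betw_def inj_on_def using assms(7) \<phi> by (auto simp: image_image)
  then show ?thesis
    unfolding linear_iso_betw_def using assms \<phi> by (intro exI [of _ \<phi>]) auto
qed

context vector_space
begin

lemma coset_eq_iff:
  assumes "subspace W"
  shows "v +o W = w +o W \<longleftrightarrow> v - w \<in> W"
proof
  assume "v +o W = w +o W"
  moreover have "v \<in> v +o W"
    using set_plus_intro2 [OF subspace_0 [OF assms], of v] by simp
  ultimately have "v \<in> w +o W" by simp
  then show "v - w \<in> W" by (auto simp: elt_set_plus_def)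
next
  have sub: "a +o W \<subseteq> b +o W" if "a - b \<in> W" for a b
  proof
    fix u assume "u \<in> a +o W"
    then obtain x where x: "x \<in> W" "u = a + x" by (auto simp: elt_set_plus_def)
    then have "(a - b) + x \<in> W" using that assms subspace_add by blast
    then show "u \<in> b +o W" using x by (force simp: elt_set_plus_def)
  qed
  assume "v - w \<in> W"
  moreover from this have "w - v \<in> W"
    using assms subspace_neg by (metis minus_diff_eq)
  ultimately show "v +o W = w +o W" using sub by blast
qed

text \<open>An element of the iterated quotient is a set of cosets of \<open>B\<close>. This form
  lists its members by representatives, on which the facts below are checked.\<close>

lemma iterated_coset:
  "(v +o B) +o ((\<lambda>s. s +o B) ` S) = (\<lambda>s. (v + s) +o B) ` S" if "subspace B"
proof -
  have "(v +o B) +o ((\<lambda>s. s +o B) ` S) = (\<lambda>s. (v +o B) + (s +o B)) ` S"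
    by (auto simp: elt_set_plus_def)
  then show ?thesis using quotient_operations(1) [OF that] by simp
qed

text \<open>The third isomorphism theorem on elements: dividing by \<open>B\<close> and then by the
  image of \<open>S\<close> identifies the same vectors as dividing by \<open>S + B\<close>.\<close>

lemma iterated_coset_eq_iff:
  assumes S: "subspace S" and B: "subspace B"
  shows "(v +o B) +o ((\<lambda>s. s +o B) ` S) = (w +o B) +o ((\<lambda>s. s +o B) ` S) \<longleftrightarrow> v - w \<in> S + B"
    (is "?l v = ?l w \<longleftrightarrow> _")
proof
  assume "?l v = ?l w"
  \<comment> \<open>The member of the left-hand side given by 0 in \<open>S\<close> must occur on
    the right.\<close>
  then have "(v + 0) +o B \<in> (\<lambda>s. (w + s) +o B) ` S"
    unfolding iterated_coset [OF B] using subspace_0 [OF S] by blast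
  then obtain s where s: "s \<in> S" "v - (w + s) \<in> B" using coset_eq_iff [OF B] by auto
  then have "v - w = s + (v - (w + s))" by simp
  then show "v - w \<in> S + B" using s set_plus_intro by metis
next
  have sub: "?l a \<subseteq> ?l b" if ab: "a - b \<in> S + B" for a b
  proof
    obtain t u where t: "t \<in> S" "u \<in> B" "a - b = t + u" using ab by (auto elim: set_plus_elim)
    fix C assume "C \<in> ?l a"
    then obtain s where s: "s \<in> S" "C = (a + s) +o B" unfolding iterated_coset [OF B] by blast
    have "(a + s) - (b + (t + s)) = u" using t(3) by (simp add: algebra_simps)
    then have "C = (b + (t + s)) +o B" using s(2) t(2) coset_eq_iff [OF B] by simp
    moreover have "t + s \<in> S" using S s t subspace_add by blast
    ultimately show "C \<in> ?l b" unfolding iterated_coset [OF B] by blast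
  qed
  assume "v - w \<in> S + B"
  moreover from this obtain t u where "t \<in> S" "u \<in> B" "v - w = t + u"
    by (auto elim: set_plus_elim)
  then have "w - v = - t + - u" by (simp add: algebra_simps)
  then have "w - v \<in> S + B"
    using \<open>t \<in> S\<close> \<open>u \<in> B\<close> S B subspace_neg set_plus_intro by metis
  ultimately show "?l v = ?l w" using sub by blast
qed

lemma iterated_coset_add:
  assumes S: "subspace S" and B: "subspace B"
  shows "((v +o B) +o ((\<lambda>s. s +o B) ` S)) + ((w +o B) +o ((\<lambda>s. s +o B) ` S)) =
    ((v + w) +o B) +o ((\<lambda>s. s +o B) ` S)"
    (is "?l v + ?l w = _")
proof -
  have "?l v + ?l w = {(v + s) +o B + (w + t) +o B | s t. s \<in> S \<and> t \<in> S}"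
    unfolding iterated_coset [OF B] set_plus_def by blast
  also have "\<dots> = {(v + w + (s + t)) +o B | s t. s \<in> S \<and> t \<in> S}"
    unfolding quotient_operations(1) [OF B] by (simp add: algebra_simps)
  also have "\<dots> = (\<lambda>s. (v + w + s) +o B) ` S"
  proof -
    have "\<exists>t u. s = t + u \<and> t \<in> S \<and> u \<in> S" if "s \<in> S" for s
      using that subspace_0 [OF S] by (intro exI [of _ s] exI [of _ 0]) simp
    then show ?thesis using subspace_add [OF S] by blast
  qed
  finally show ?thesis unfolding iterated_coset [OF B] .
qed

text \<open>The union in \<open>quotient_scale\<close> ranges over the members of the coset.
  Changing the member alters the scaled representative only by an element of \<open>S\<close>, so
  all terms of the union agree; there is at least one since \<open>S\<close> contains 0.\<close>

lemma iterated_coset_scale: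
  assumes S: "subspace S" and B: "subspace B"
  shows "quotient_scale (quotient_scale scale B) ((\<lambda>s. s +o B) ` S) c
      ((v +o B) +o ((\<lambda>s. s +o B) ` S)) =
    (scale c v +o B) +o ((\<lambda>s. s +o B) ` S)"
    (is "_ = ?r")
proof -
  have "(scale c (v + s) +o B) +o ((\<lambda>s. s +o B) ` S) = ?r" if "s \<in> S" for s
  proof -
    have "scale c (v + s) - scale c v = scale c s + 0" by (simp add: scale_right_distrib)
    then have "scale c (v + s) - scale c v \<in> S + B"
      using subspace_scale [OF S that] subspace_0 [OF B] set_plus_intro by metis
    then show ?thesis using iterated_coset_eq_iff [OF S B] by blast
  qed
  moreover have "S \<noteq> {}" using subspace_0 [OF S] by blast
  ultimately show ?thesis
    unfolding quotient_scale_def [of "quotient_scale scale B"]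
    unfolding iterated_coset [OF B, of v] by (simp add: quotient_operations(2) [OF B])
qed

end

subsection \<open>The Cayley complex\<close>

lemma ex_bit: "(\<exists>k :: bit. P k) \<longleftrightarrow> P 0 \<or> P 1"
  by (metis bit_not_zero_iff)

lemma span_singleton_bit: "vec.span {x :: bit ^ 'k} = {0, x}"
  by (auto simp: vec.span_breakdown_eq ex_bit bit_vec_add_eq_0_iff)

lemma span_pair_bit: "vec.span {x, y :: bit ^ 'k} = {0, x, y, x + y}"
  unfolding set_eq_iff vec.span_breakdown_eq [of _ x] ex_bit span_singleton_bit
  by (auto simp: bit_vec_add_eq_0_iff add_ac)

definition cayley_edge :: "bit ^ 'k::finite \<Rightarrow> bit ^ 'k \<Rightarrow> (bit ^ 'k) set \<Rightarrow> bit" where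
  "cayley_edge v x = indicator {{v, v + x}}"

text \<open>An edge carries the same label from either end because \<open>x + x = 0\<close>.\<close>

lemma cayley_edge_flip: "cayley_edge (v + x) x = cayley_edge v x"
  by (simp add: cayley_edge_def add.assoc insert_commute)

lemma swap_cycle_eq:
  "swap_cycle v x y = cayley_edge v x + cayley_edge (v + x) y + cayley_edge (v + y) x + cayley_edge v y"
  by (simp add: swap_cycle_def cayley_edge_def add_ac)

text \<open>For \<open>S = points X\<close> this is the product of the transpose of \<open>G\<close>
  with \<open>y\<close>, kept as a vector. The set \<open>S\<close> is a parameter so that walks can
  be built one generator at a time.\<close>

definition point_sum :: "(bit ^ 'k::finite) set \<Rightarrow> (bit ^ 'k \<Rightarrow> bit) \<Rightarrow> bit ^ 'k" where
  "point_sum S y = (\<Sum>x\<in>S. y x *s x)"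

lemma point_sum_0 [simp]: "point_sum S 0 = 0"
  by (simp add: point_sum_def pointwise)

lemma point_sum_add: "point_sum S (y + z) = point_sum S y + point_sum S z"
  by (simp add: point_sum_def pointwise vec.scale_left_distrib sum.distrib)

lemma point_sum_indicator [simp]:
  fixes x :: "bit ^ 'k::finite"
  shows "point_sum S (indicator {x}) = (if x \<in> S then x else 0)"
proof -
  have "indicator {x} z *s z = (if z = x then x else 0)" for z :: "bit ^ 'k"
    by (auto simp: indicator_def)
  then show ?thesis by (simp add: point_sum_def)
qed

lemma point_sum_insert:
  "a \<notin> S \<Longrightarrow> point_sum (insert a S) y = y a *s a + point_sum S y"
  by (simp add: point_sum_def)

lemma ker_G_transpose_eq:
  "ker_G_transpose X = {y \<in> coord_space (points X). point_sum (points X) y = 0}"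
  by (auto simp: ker_G_transpose_def point_sum_def transpose_mult_def G_matrix_def vec_eq_iff
      fun_eq_iff pointwise mult.commute)

lemma zero_in_cayley_vertices [simp]: "0 \<in> cayley_vertices X"
  by (simp add: cayley_vertices_def vec.span_zero)

lemma cayley_vertices_add:
  "v \<in> cayley_vertices X \<Longrightarrow> w \<in> cayley_vertices X \<Longrightarrow> v + w \<in> cayley_vertices X"
  by (simp add: cayley_vertices_def vec.span_add)

lemma points_subset_cayley_vertices: "x \<in> points X \<Longrightarrow> x \<in> cayley_vertices X"
  by (simp add: cayley_vertices_def vec.span_base)

lemma point_sum_in_cayley_vertices: "S \<subseteq> points X \<Longrightarrow> point_sum S y \<in> cayley_vertices X"
  unfolding point_sum_def cayley_vertices_def
  by (intro vec.span_sum vec.span_scale vec.span_base) auto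

lemma points_nonzero: "x \<in> points X \<Longrightarrow> x \<noteq> 0"
  by (simp add: points_def)

lemma card_edge: "(x :: bit ^ 'k) \<noteq> 0 \<Longrightarrow> card {v, v + x} = 2"
  by (simp add: card_insert_if)

lemma card_triangle:
  "(x :: bit ^ 'k) \<noteq> 0 \<Longrightarrow> y \<noteq> 0 \<Longrightarrow> x \<noteq> y \<Longrightarrow> card {v, v + x, v + y} = 3"
  by (simp add: card_insert_if)

lemma vertices_cayley_complex:
  "simplices (cayley_complex X) 0 = {{v} | v. v \<in> cayley_vertices X}"
  unfolding simplices_def cayley_complex_def
  by (auto simp: card_edge card_triangle points_nonzero)

lemma edges_cayley_complex:
  "simplices (cayley_complex X) 1 = {{v, v + x} | v x. v \<in> cayley_vertices X \<and> x \<in> points X}"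
  unfolding simplices_def cayley_complex_def
  by (auto simp: card_edge card_triangle points_nonzero)

lemma triangles_cayley_complex:
  "simplices (cayley_complex X) 2 =
    {{v, v + x, v + y} | v x y. v \<in> cayley_vertices X \<and> x \<in> points X \<and> y \<in> points X \<and>
        x \<noteq> y \<and> vec.span {x, y} \<in> gfaces X 1}"
    (is "_ = ?T")
proof
  show "simplices (cayley_complex X) 2 \<subseteq> ?T"
  proof
    fix \<sigma> assume "\<sigma> \<in> simplices (cayley_complex X) 2"
    then have "\<sigma> \<in> cayley_complex X" "card \<sigma> = 3" by (auto simp: simplices_def)
    moreover have "card {v, v + x} \<noteq> 3" for v x :: "bit ^ 'a"
      by (simp add: card_insert_if)
    ultimately show "\<sigma> \<in> ?T" unfolding cayley_complex_def by auto
  qed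
  show "?T \<subseteq> simplices (cayley_complex X) 2"
  proof
    fix \<sigma> assume "\<sigma> \<in> ?T"
    then have "\<sigma> \<in> cayley_complex X" unfolding cayley_complex_def by blast
    moreover have "card \<sigma> = 3" using \<open>\<sigma> \<in> ?T\<close> by (auto simp: card_triangle points_nonzero)
    ultimately show "\<sigma> \<in> simplices (cayley_complex X) 2" by (simp add: simplices_def)
  qed
qed

lemma edge_iff:
  assumes "v \<in> cayley_vertices X" "w \<in> cayley_vertices X"
  shows "{v, w} \<in> simplices (cayley_complex X) 1 \<longleftrightarrow> v + w \<in> points X"
proof
  assume "{v, w} \<in> simplices (cayley_complex X) 1"
  then show "v + w \<in> points X"
    unfolding edges_cayley_complex by (auto simp: doubleton_eq_iff add_ac)
next
  assume "v + w \<in> points X"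
  then have "{v, v + (v + w)} \<in> simplices (cayley_complex X) 1"
    unfolding edges_cayley_complex using assms by blast
  then show "{v, w} \<in> simplices (cayley_complex X) 1" by simp
qed

section \<open>Boundaries of edges and triangles\<close>

lemma boundary_add: "boundary K n (c + d) = boundary K n c + boundary K n d"
  by (auto simp: boundary_def sum.distrib fun_eq_iff pointwise)

lemma boundary_0 [simp]: "boundary K n 0 = 0"
  by (auto simp: boundary_def fun_eq_iff pointwise)

lemma boundary_indicator:
  assumes "\<sigma> \<in> simplices K (Suc n)" "finite K"
  shows "boundary K (Suc n) (indicator {\<sigma>}) = indicator {\<tau> \<in> simplices K n. \<tau> \<subseteq> \<sigma>}"
proof
  fix \<tau>
  have "(\<Sum>\<rho> | \<rho> \<in> simplices K (Suc n) \<and> \<tau> \<subseteq> \<rho>. indicator {\<sigma>} \<rho> :: bit) =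
      (\<Sum>\<rho> | \<rho> \<in> simplices K (Suc n) \<and> \<tau> \<subseteq> \<rho>. if \<rho> = \<sigma> then 1 else 0)"
    by (rule sum.cong) (auto simp: indicator_def)
  also have "\<dots> = (if \<tau> \<subseteq> \<sigma> then 1 else 0)"
    using assms by (subst sum.delta) (auto simp: simplices_def)
  finally show "boundary K (Suc n) (indicator {\<sigma>}) \<tau> = indicator {\<tau> \<in> simplices K n. \<tau> \<subseteq> \<sigma>} \<tau>"
    by (auto simp: boundary_def simplices_def indicator_def)
qed

lemma boundary_edge:
  assumes "v \<in> cayley_vertices X" "x \<in> points X"
  shows "boundary (cayley_complex X) 1 (cayley_edge v x) = indicator {{v}} + indicator {{v + x}}"
proof -
  have 1: "{v, v + x} \<in> simplices (cayley_complex X) (Suc 0)"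
    using assms edges_cayley_complex by auto
  have "{\<tau> \<in> simplices (cayley_complex X) 0. \<tau> \<subseteq> {v, v + x}} = {{v}, {v + x}}"
    unfolding vertices_cayley_complex
    using assms cayley_vertices_add points_subset_cayley_vertices by blast
  moreover have "x \<noteq> 0" using assms points_nonzero by blast
  ultimately show ?thesis
    unfolding cayley_edge_def using boundary_indicator [OF 1]
    by (auto simp: indicator_def fun_eq_iff pointwise)
qed

text \<open>The third side joins \<open>v + x\<close> to \<open>v + y\<close>, so its label is
  \<open>x + y\<close>.\<close>

lemma boundary_triangle:
  assumes "v \<in> cayley_vertices X" "x \<in> points X" "y \<in> points X" "x + y \<in> points X"
    "vec.span {x, y} \<in> gfaces X 1"
  shows "boundary (cayley_complex X) 2 (indicator {{v, v + x, v + y}}) =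
    cayley_edge v x + cayley_edge v y + cayley_edge (v + x) (x + y)"
proof -
  let ?K = "cayley_complex X"
  have ne: "x \<noteq> 0" "y \<noteq> 0" "x \<noteq> y" using assms points_nonzero by force+
  have A: "v + x \<in> cayley_vertices X" "v + y \<in> cayley_vertices X"
    using assms cayley_vertices_add points_subset_cayley_vertices by blast+
  have "{v, v + x, v + y} \<in> simplices ?K 2"
    unfolding triangles_cayley_complex using assms ne by blast
  then have 1: "{v, v + x, v + y} \<in> simplices ?K (Suc 1)" by (simp add: numeral_2_eq_2)
  have "{\<tau> \<in> simplices ?K 1. \<tau> \<subseteq> {v, v + x, v + y}} = {{v, v + x}, {v, v + y}, {v + x, v + y}}"
  proof
    show "{{v, v + x}, {v, v + y}, {v + x, v + y}} \<subseteq> {\<tau> \<in> simplices ?K 1. \<tau> \<subseteq> {v, v + x, v + y}}"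
      using assms A edge_iff [of v X "v + x"] edge_iff [of v X "v + y"] edge_iff [of "v + x" X "v + y"]
      by (auto simp: add_ac)
    show "{\<tau> \<in> simplices ?K 1. \<tau> \<subseteq> {v, v + x, v + y}} \<subseteq> {{v, v + x}, {v, v + y}, {v + x, v + y}}"
    proof
      fix \<tau> assume "\<tau> \<in> {\<tau> \<in> simplices ?K 1. \<tau> \<subseteq> {v, v + x, v + y}}"
      then have "card \<tau> = 2" "\<tau> \<subseteq> {v, v + x, v + y}" by (auto simp: simplices_def)
      moreover from this obtain a b where "\<tau> = {a, b}" "a \<noteq> b" by (meson card_2_iff)
      ultimately show "\<tau> \<in> {{v, v + x}, {v, v + y}, {v + x, v + y}}" by auto
    qed
  qed
  moreover have "{v, v + x} \<noteq> {v, v + y}" "{v, v + x} \<noteq> {v + x, v + y}" "{v, v + y} \<noteq> {v + x, v + y}"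
    using ne by (auto simp: doubleton_eq_iff)
  ultimately show ?thesis
    unfolding cayley_edge_def using boundary_indicator [OF 1]
    by (auto simp: indicator_def fun_eq_iff pointwise add_ac numeral_2_eq_2)
qed

section \<open>Labels of edges and chains\<close>

lemma edge_label_map_add: "edge_label_map X (c + d) = edge_label_map X c + edge_label_map X d"
  by (auto simp: edge_label_map_def sum.distrib fun_eq_iff pointwise)

lemma edge_label_map_0 [simp]: "edge_label_map X 0 = 0"
  by (auto simp: edge_label_map_def fun_eq_iff pointwise)

text \<open>\<open>edge_label_map\<close> sums over a set of edges, so \<open>{v, v + x}\<close>
  counts once although both of its endpoints produce it. Counted once per starting vertex, the label
  would vanish.\<close>

lemma edge_label_map_edge:
  assumes "v \<in> cayley_vertices X" "x \<in> points X"
  shows "edge_label_map X (cayley_edge v x) = indicator {x}"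
proof
  fix z
  have "(\<Sum>e\<in>{{w, w + z} | w. w \<in> cayley_vertices X}. cayley_edge v x e) =
      (\<Sum>e\<in>{{w, w + z} | w. w \<in> cayley_vertices X}. if e = {v, v + x} then 1 else 0)"
    by (rule sum.cong) (auto simp: indicator_def cayley_edge_def)
  also have "\<dots> = (if {v, v + x} \<in> {{w, w + z} | w. w \<in> cayley_vertices X} then 1 else 0)"
    by (subst sum.delta) auto
  also have "{v, v + x} \<in> {{w, w + z} | w. w \<in> cayley_vertices X} \<longleftrightarrow> z = x"
    using assms by (auto simp: doubleton_eq_iff add.assoc bit_vec_add_eq_0_iff)
  finally show "edge_label_map X (cayley_edge v x) z = indicator {x} z"
    using assms by (auto simp: edge_label_map_def indicator_def)
qed

lemma edge_label_map_in_coord_space: "edge_label_map X c \<in> coord_space (points X)"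
  by (simp add: edge_label_map_def coord_space_def)

lemma cayley_chain_induct [consumes 1, case_names zero add]:
  assumes "c \<in> chains (cayley_complex X) 1" "P 0"
    and "\<And>c v x. c \<in> chains (cayley_complex X) 1 \<Longrightarrow> v \<in> cayley_vertices X \<Longrightarrow> x \<in> points X \<Longrightarrow>
      P c \<Longrightarrow> P (c + cayley_edge v x)"
  shows "P c"
proof -
  have "finite (simplices (cayley_complex X) 1)" by simp
  then show ?thesis
    using assms(1) unfolding chains_def
  proof (induction rule: coord_space_induct)
    case (add c e)
    then obtain v x where "v \<in> cayley_vertices X" "x \<in> points X" "e = {v, v + x}"
      unfolding edges_cayley_complex by blast
    then show ?case
      using add assms(3) unfolding chains_def cayley_edge_def by blast
  qed (rule assms(2))
qed

lemma subspace_chains: "fspace.subspace (chains K n)"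
  unfolding chains_def by (rule subspace_coord_space)

lemma subspace_cycles: "fspace.subspace (cycles K n)"
  by (rule subspace_bit_funI) (auto simp: cycles_def chains_def boundary_add coord_space_def pointwise)

lemma subspace_boundaries: "fspace.subspace (boundaries K n)"
proof (rule subspace_bit_funI)
  have "boundary K (n + 1) 0 \<in> boundaries K n"
    unfolding boundaries_def by (rule imageI [OF fspace.subspace_0 [OF subspace_chains]])
  then show "0 \<in> boundaries K n" by simp
  fix f g assume "f \<in> boundaries K n" "g \<in> boundaries K n"
  then obtain c d where "f = boundary K (n + 1) c" "c \<in> chains K (n + 1)"
    "g = boundary K (n + 1) d" "d \<in> chains K (n + 1)"
    unfolding boundaries_def by blast
  moreover from this have "c + d \<in> chains K (n + 1)"
    by (intro fspace.subspace_add [OF subspace_chains])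
  ultimately show "f + g \<in> boundaries K n"
    unfolding boundaries_def by (simp add: boundary_add [symmetric])
qed

lemma subspace_swap_cycles: "fspace.subspace (swap_cycles X)"
  unfolding swap_cycles_def by (rule fspace.subspace_span)

lemma cayley_edge_in_chains:
  "v \<in> cayley_vertices X \<Longrightarrow> x \<in> points X \<Longrightarrow> cayley_edge v x \<in> chains (cayley_complex X) 1"
  unfolding cayley_edge_def chains_def edges_cayley_complex
  by (rule indicator_in_coord_space) blast


subsection \<open>The kernel of the edge label map\<close>

text \<open>
  \<open>P y\<close> is the chain of a walk from \<open>0\<close> that uses the generator \<open>x\<close> exactly \<open>y x\<close> times.
  Modulo swap cycles it depends neither on the order of the steps nor on cancelling pairs
  of equal steps.
\<close>

lemma walk_chains_exist:
  assumes "S \<subseteq> points X"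
  shows "\<exists>P. P 0 = 0 \<and>
    (\<forall>y. \<forall>x\<in>S. P (y + indicator {x}) + P y + cayley_edge (point_sum S y) x \<in> swap_cycles X) \<and>
    (\<forall>y x. x \<notin> S \<longrightarrow> P (y + indicator {x}) = P y)"
proof -
  have "finite S" by simp
  then show ?thesis
    using assms
  proof (induction S rule: finite_induct)
    case empty
    then show ?case by (intro exI [of _ "\<lambda>_. 0"]) simp
  next
    case (insert a S)
    then obtain P where P0: "P 0 = 0"
      and P: "\<And>y x. x \<in> S \<Longrightarrow>
        P (y + indicator {x}) + P y + cayley_edge (point_sum S y) x \<in> swap_cycles X"
      and P_out: "\<And>y x. x \<notin> S \<Longrightarrow> P (y + indicator {x}) = P y"
      by (metis insert_subset)
    \<comment> \<open>The new walk first uses the generators in \<open>S\<close> and then takes one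
      step along \<open>a\<close> if \<open>y a = 1\<close>.\<close>
    let ?e = "\<lambda>y. cayley_edge (point_sum S y) a"
    let ?P = "\<lambda>y. P y + fscale (y a) (?e y)"
    have "?P (y + indicator {x}) + ?P y + cayley_edge (point_sum (insert a S) y) x \<in> swap_cycles X"
      if x: "x \<in> insert a S" for x y
    proof (cases "x = a")
      case True
      have "point_sum S (y + indicator {a}) = point_sum S y"
        using insert.hyps by (simp add: point_sum_add)
      \<comment> \<open>This is what the third clause of the induction claim is for: the earlier
        walk ignores generators outside \<open>S\<close>.\<close>
      moreover have "P (y + indicator {a}) = P y" using P_out insert.hyps by blast
      \<comment> \<open>If \<open>y a = 1\<close>, the walk already ends with this edge, now read
        from its other end.\<close>
      moreover have "cayley_edge (point_sum (insert a S) y) a = ?e y"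
        using insert.hyps cayley_edge_flip [of "point_sum S y" a]
        by (cases "y a") (simp_all add: point_sum_insert add.commute)
      moreover have "fscale ((y + indicator {a}) a) (?e y) = fscale (y a) (?e y) + ?e y"
        by (cases "y a") (simp_all add: fscale_bit pointwise)
      ultimately have "?P (y + indicator {x}) + ?P y + cayley_edge (point_sum (insert a S) y) x = 0"
        using True by (simp add: add_ac)
      then show ?thesis using fspace.subspace_0 [OF subspace_swap_cycles] by metis
    next
      case False
      then have xS: "x \<in> S" using x by blast
      let ?w = "point_sum S y"
      have "x \<in> points X" "a \<in> points X" "S \<subseteq> points X" using insert.prems xS by auto
      \<comment> \<open>The induction hypothesis supplies the edge \<open>x\<close> before the step
        along \<open>a\<close>, while the claim has it after that step. The discrepancy is this
        square, present only if \<open>y a = 1\<close>.\<close>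
      then have "swap_cycle ?w x a \<in> swap_cycles X"
        unfolding swap_cycles_def
        using point_sum_in_cayley_vertices by (intro fspace.span_base) blast
      then have swap: "fscale (y a) (swap_cycle ?w x a) \<in> swap_cycles X"
        by (rule fspace.subspace_scale [OF subspace_swap_cycles])
      have *: "P (y + indicator {x}) + P y + cayley_edge ?w x + fscale (y a) (swap_cycle ?w x a)
          \<in> swap_cycles X"
        by (rule fspace.subspace_add [OF subspace_swap_cycles P [OF xS] swap])
      have "point_sum S (y + indicator {x}) = ?w + x" using xS by (simp add: point_sum_add)
      moreover have "(y + indicator {x}) a = y a" using False by (simp add: pointwise)
      ultimately have "?P (y + indicator {x}) + ?P y + cayley_edge (point_sum (insert a S) y) x =
          P (y + indicator {x}) + P y + cayley_edge ?w x + fscale (y a) (swap_cycle ?w x a)"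
        using insert.hyps
        by (cases "y a") (simp_all add: fscale_bit point_sum_insert swap_cycle_eq add_ac)
      then show ?thesis using * by metis
    qed
    moreover have "?P (y + indicator {x}) = ?P y" if "x \<notin> insert a S" for x y
      using that P_out [of x y] by (cases "a = x") (simp_all add: point_sum_add pointwise)
    moreover have "?P 0 = 0" using P0 by (simp add: fscale_bit pointwise)
    ultimately show ?case by (intro exI [of _ ?P]) blast
  qed
qed

text \<open>Gives every vertex the labels of a walk from 0 to it; \<open>cycle_labels\<close>
  chooses its section from these. Adding \<open>indicator {x}\<close> toggles the entry at
  \<open>x\<close> and moves the endpoint by \<open>x\<close> in either case.\<close>

lemma cayley_vertex_point_sum:
  assumes "v \<in> cayley_vertices X"
  shows "\<exists>y\<in>coord_space (points X). point_sum (points X) y = v"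
  using assms unfolding cayley_vertices_def
proof (induction rule: vec.span_induct_alt)
  case base
  show ?case
  proof
    show "0 \<in> coord_space (points X)" by (rule fspace.subspace_0 [OF subspace_coord_space])
  qed simp
next
  case (step c x v)
  then obtain y where y: "y \<in> coord_space (points X)" "point_sum (points X) y = v" by blast
  show ?case
  proof (cases "c = 1")
    case True
    show ?thesis
    proof
      show "y + indicator {x} \<in> coord_space (points X)"
        by (rule fspace.subspace_add [OF subspace_coord_space y(1) indicator_in_coord_space [OF step.hyps(1)]])
      show "point_sum (points X) (y + indicator {x}) = c *s x + v"
        using True step.hyps(1) y(2) unfolding point_sum_add by (simp add: add.commute)
    qed
  next
    case False
    then show ?thesis using y by auto
  qed
qed

text \<open>The linear extension of \<open>h\<close> from vertices to 0-chains. Composed with the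
  boundary it vanishes on cycles, which removes the choice of walks at the end.\<close>

definition vertex_sum :: "'v set \<Rightarrow> ('v \<Rightarrow> 'a \<Rightarrow> bit) \<Rightarrow> ('v set \<Rightarrow> bit) \<Rightarrow> 'a \<Rightarrow> bit" where
  "vertex_sum A h d = (\<Sum>v\<in>A. fscale (d {v}) (h v))"

lemma vertex_sum_0 [simp]: "vertex_sum A h 0 = 0"
  by (simp add: vertex_sum_def pointwise)

lemma vertex_sum_add: "vertex_sum A h (c + d) = vertex_sum A h c + vertex_sum A h d"
  by (simp add: vertex_sum_def pointwise fspace.scale_left_distrib sum.distrib)

lemma vertex_sum_indicator:
  assumes "v \<in> A" "finite A"
  shows "vertex_sum A h (indicator {{v}}) = h v"
proof -
  have "vertex_sum A h (indicator {{v}}) = (\<Sum>w\<in>A. if w = v then h w else 0)"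
    unfolding vertex_sum_def by (rule sum.cong) (auto simp: fscale_bit indicator_def)
  then show ?thesis using assms by simp
qed

text \<open>
  Writing the edge from \<open>v\<close> to \<open>v + x\<close> as a difference of walks from \<open>0\<close> along a section \<open>s\<close> of
  \<^const>\<open>point_sum\<close> expresses every chain, modulo swap cycles, by its boundary and its labels.
\<close>

lemma cycle_labels:
  fixes X :: "(bit ^ 'k::finite) set set"
  assumes z: "z \<in> cycles (cayley_complex X) 1"
  shows "point_sum (points X) (edge_label_map X z) = 0"
    and "edge_label_map X z = 0 \<Longrightarrow> z \<in> swap_cycles X"
proof -
  let ?C = "coord_space (points X)" and ?G = "point_sum (points X)" and ?S = "swap_cycles X"
  let ?A = "cayley_vertices X" and ?d = "boundary (cayley_complex X) 1"
  note S_add = fspace.subspace_add [OF subspace_swap_cycles]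
  note C_add = fspace.subspace_add [OF subspace_coord_space]
  obtain P where P0: "P 0 = 0"
    and P_step: "\<And>y x. x \<in> points X \<Longrightarrow> P (y + indicator {x}) + P y + cayley_edge (?G y) x \<in> ?S"
    using walk_chains_exist [of "points X" X] by auto
  \<comment> \<open>Induction on \<open>y\<close>: since \<open>k\<close> has point sum 0, the walks
    of \<open>y\<close> and \<open>y + k\<close> end at the same vertex, so a further generator
    appends the same edge to both and the two copies cancel.\<close>
  have P_add: "P (y + k) + P y + P k \<in> ?S" if k: "?G k = 0" and y: "y \<in> ?C" for y k
  proof -
    have "finite (points X)" by simp
    then show ?thesis
      using y
    proof (induction rule: coord_space_induct)
      case zero
      show ?case using P0 fspace.subspace_0 [OF subspace_swap_cycles] by simp
    next
      case (add y x)
      let ?e = "cayley_edge (?G y) x"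
      have "P (y + k + indicator {x}) + P (y + k) + ?e \<in> ?S"
        using P_step [OF \<open>x \<in> points X\<close>, of "y + k"] k by (simp add: point_sum_add)
      moreover have "P (y + indicator {x}) + P y + ?e \<in> ?S"
        using P_step \<open>x \<in> points X\<close> by blast
      ultimately have "(P (y + k + indicator {x}) + P (y + k) + ?e) +
          (P (y + indicator {x}) + P y + ?e) + (P (y + k) + P y + P k) \<in> ?S"
        using add.IH by (rule S_add [OF S_add])
      then show ?case by (simp add: add_ac)
    qed
  qed
  obtain s where s_C: "\<And>v. v \<in> ?A \<Longrightarrow> s v \<in> ?C" and G_s: "\<And>v. v \<in> ?A \<Longrightarrow> ?G (s v) = v"
    using cayley_vertex_point_sum [of _ X] by metis
  \<comment> \<open>\<open>?F c\<close> collects the chosen walks to the boundary vertices of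
    \<open>c\<close>. \<open>?M c\<close> corrects the labels of \<open>c\<close> by those walks, so
    that they lie in the kernel even if \<open>c\<close> is not a cycle.\<close>
  let ?F = "\<lambda>c. vertex_sum ?A (P \<circ> s) (?d c)"
  let ?M = "\<lambda>c. edge_label_map X c + vertex_sum ?A s (?d c)"
  have main: "?M c \<in> ?C \<and> ?G (?M c) = 0 \<and> c + ?F c + P (?M c) \<in> ?S"
    if "c \<in> chains (cayley_complex X) 1" for c
    using that
  proof (induction rule: cayley_chain_induct)
    case zero
    show ?case
      using P0 by (simp add: fspace.subspace_0 [OF subspace_swap_cycles]
        fspace.subspace_0 [OF subspace_coord_space])
  next
    case (add c v x)
    \<comment> \<open>\<open>?k\<close> holds the labels of the closed walk that follows
      \<open>s v\<close>, crosses the edge and returns along \<open>s (v + x)\<close>.\<close>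
    let ?e = "cayley_edge v x" and ?k = "indicator {x} + s v + s (v + x)"
    note v = add.hyps(2) and x = add.hyps(3)
    have vx: "v + x \<in> ?A"
      by (rule cayley_vertices_add [OF v points_subset_cayley_vertices [OF x]])
    have k_C: "?k \<in> ?C"
      by (intro C_add indicator_in_coord_space s_C v vx x)
    have k_G: "?G ?k = 0"
      using x by (simp add: point_sum_add G_s [OF v] G_s [OF vx] add_ac)
    have M: "?M (c + ?e) = ?M c + ?k"
      unfolding edge_label_map_add edge_label_map_edge [OF v x] boundary_add boundary_edge [OF v x]
        vertex_sum_add vertex_sum_indicator [OF v finite] vertex_sum_indicator [OF vx finite]
      by (simp only: add_ac)
    have F: "?F (c + ?e) = ?F c + (P (s v) + P (s (v + x)))"
      unfolding boundary_add boundary_edge [OF v x] vertex_sum_add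
        vertex_sum_indicator [OF v finite] vertex_sum_indicator [OF vx finite] o_apply ..
    have M_C: "?M c \<in> ?C" and M_G: "?G (?M c) = 0" and c: "c + ?F c + P (?M c) \<in> ?S"
      using add.IH by blast+
    have walk_M: "P (?M c + ?k) + P (?M c) + P ?k \<in> ?S"
      by (rule P_add [OF k_G M_C])
    \<comment> \<open>The walk to \<open>v\<close> continued by \<open>x\<close> and the chosen walk
      to \<open>v + x\<close> have the same endpoint and labels differing by \<open>?k\<close>, so
      \<open>P_add\<close> compares them.\<close>
    have walk_vx: "P (s v + indicator {x}) + P (s (v + x)) + P ?k \<in> ?S"
    proof -
      have "s (v + x) + ?k = s v + indicator {x}" by (simp add: add_ac)
      then show ?thesis using P_add [OF k_G s_C [OF vx]] by (simp only:)
    qed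
    have walk_v: "P (s v + indicator {x}) + P (s v) + ?e \<in> ?S"
      using P_step [OF x, of "s v"] G_s [OF v] by (simp only:)
    have "(c + ?F c + P (?M c)) + (P (?M c + ?k) + P (?M c) + P ?k) +
        (P (s v + indicator {x}) + P (s (v + x)) + P ?k) +
        (P (s v + indicator {x}) + P (s v) + ?e) \<in> ?S"
      by (rule S_add [OF S_add [OF S_add [OF c walk_M] walk_vx] walk_v])
    \<comment> \<open>In the sum of the four relations, \<open>P (?M c)\<close>, \<open>P ?k\<close>
      and \<open>P (s v + indicator {x})\<close> each occur twice; they are \<open>d\<close>,
      \<open>g\<close> and \<open>h\<close> here.\<close>
    moreover have "(a + b + d) + (f + d + g) + (h + i + g) + (h + j + e) = (a + e) + (b + (j + i)) + f"
      for a b d e f g h i j :: "(bit ^ 'k) set \<Rightarrow> bit"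
      by (simp add: add_ac)
    ultimately have "(c + ?e) + (?F c + (P (s v) + P (s (v + x)))) + P (?M c + ?k) \<in> ?S"
      by (simp only:)
    moreover have "?M c + ?k \<in> ?C" by (rule C_add [OF M_C k_C])
    moreover have "?G (?M c + ?k) = 0" unfolding point_sum_add [of _ "?M c" ?k] M_G k_G by simp
    ultimately show ?case unfolding M F by blast
  qed
  have z': "z \<in> chains (cayley_complex X) 1" "?d z = 0" using z unfolding cycles_def by blast+
  \<comment> \<open>On a cycle both vertex sums vanish, leaving \<open>z\<close> plus the walk of
    its labels.\<close>
  then have "?M z = edge_label_map X z" "?F z = 0"
    by (simp_all only: vertex_sum_0 add_0_right)
  then have "?G (edge_label_map X z) = 0" "z + P (edge_label_map X z) \<in> ?S"
    using main [OF z'(1)] by (simp_all only: add_0_right)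
  then show "?G (edge_label_map X z) = 0" "edge_label_map X z = 0 \<Longrightarrow> z \<in> ?S"
    using P0 by simp_all
qed

text \<open>Opposite sides of a square carry the same label and cancel.\<close>

lemma edge_label_map_swap_cycles:
  assumes "c \<in> swap_cycles X"
  shows "edge_label_map X c = 0"
  using assms unfolding swap_cycles_def
proof (induction rule: bit_span_induct)
  case (add f g)
  then obtain v x y where g: "g = swap_cycle v x y" "v \<in> cayley_vertices X" "x \<in> points X" "y \<in> points X"
    by blast
  then have "v + x \<in> cayley_vertices X" "v + y \<in> cayley_vertices X"
    using cayley_vertices_add points_subset_cayley_vertices by blast+
  then show ?case
    using g add.IH by (simp add: swap_cycle_eq edge_label_map_add edge_label_map_edge add_ac)
qed simp


subsection \<open>The image of the edge label map\<close>

text \<open>Surjectivity before closing up: \<open>c\<close> is a walk from 0 with the prescribed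
  labels. For \<open>y\<close> in the kernel of the transpose of \<open>G\<close> its two ends
  coincide and cancel.\<close>

lemma chain_with_labels:
  assumes "y \<in> coord_space (points X)"
  shows "\<exists>c\<in>chains (cayley_complex X) 1. edge_label_map X c = y \<and>
    boundary (cayley_complex X) 1 c = indicator {{0}} + indicator {{point_sum (points X) y}}"
proof -
  have "finite (points X)" by simp
  then show ?thesis
    using assms
  proof (induction rule: coord_space_induct)
    case zero
    show ?case
      by (intro bexI [of _ 0] fspace.subspace_0 [OF subspace_chains]) simp_all
  next
    case (add y x)
    let ?v = "point_sum (points X) y"
    obtain c where c: "c \<in> chains (cayley_complex X) 1" "edge_label_map X c = y"
      "boundary (cayley_complex X) 1 c = indicator {{0}} + indicator {{?v}}"
      using add.IH by blast
    have v: "?v \<in> cayley_vertices X" using point_sum_in_cayley_vertices by blast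
    have "c + cayley_edge ?v x \<in> chains (cayley_complex X) 1"
      by (rule fspace.subspace_add [OF subspace_chains c(1) cayley_edge_in_chains [OF v add.hyps(2)]])
    moreover have "edge_label_map X (c + cayley_edge ?v x) = y + indicator {x}"
      using c v add by (simp add: edge_label_map_add edge_label_map_edge)
    moreover have "boundary (cayley_complex X) 1 (c + cayley_edge ?v x) =
        indicator {{0}} + indicator {{point_sum (points X) (y + indicator {x})}}"
      unfolding boundary_add c(3) boundary_edge [OF v add.hyps(2)]
      using add by (simp add: point_sum_add add_ac)
    ultimately show ?case by blast
  qed
qed

lemma edge_label_map_cycles:
  "edge_label_map X ` cycles (cayley_complex X) 1 = ker_G_transpose X"
proof
  show "edge_label_map X ` cycles (cayley_complex X) 1 \<subseteq> ker_G_transpose X"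
    unfolding ker_G_transpose_eq using cycle_labels(1) edge_label_map_in_coord_space by blast
  show "ker_G_transpose X \<subseteq> edge_label_map X ` cycles (cayley_complex X) 1"
  proof
    fix y assume "y \<in> ker_G_transpose X"
    then have y: "y \<in> coord_space (points X)" "point_sum (points X) y = 0"
      by (auto simp: ker_G_transpose_eq)
    then obtain c where c: "c \<in> chains (cayley_complex X) 1" "edge_label_map X c = y"
      "boundary (cayley_complex X) 1 c = indicator {{0}} + indicator {{0}}"
      using chain_with_labels by metis
    then have "c \<in> cycles (cayley_complex X) 1" unfolding cycles_def by simp
    then show "y \<in> edge_label_map X ` cycles (cayley_complex X) 1" using c by blast
  qed
qed

section \<open>The image of the transpose of \<open>H\<close> and the labels of boundaries\<close>

lemma transpose_mult_add: "transpose_mult R M (y + z) = transpose_mult R M y + transpose_mult R M z"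
  by (simp add: transpose_mult_def fun_eq_iff pointwise distrib_left sum.distrib)

lemma transpose_mult_0 [simp]: "transpose_mult R M 0 = 0"
  by (simp add: transpose_mult_def fun_eq_iff pointwise)

lemma transpose_mult_indicator:
  assumes "finite R" "i \<in> R"
  shows "transpose_mult R M (indicator {i}) = M i"
proof
  fix j
  have "(\<Sum>k\<in>R. M k j * indicator {i} k) = (\<Sum>k\<in>R. if k = i then M k j else 0)"
    by (rule sum.cong) (auto simp: indicator_def)
  then show "transpose_mult R M (indicator {i}) j = M i j"
    using assms by (simp add: transpose_mult_def)
qed

lemma subspace_im_H_transpose: "fspace.subspace (im_H_transpose X)"
proof (rule subspace_bit_funI)
  have "transpose_mult (gfaces X 1) H_matrix 0 \<in> im_H_transpose X"
    unfolding im_H_transpose_def by (rule imageI [OF fspace.subspace_0 [OF subspace_coord_space]])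
  then show "0 \<in> im_H_transpose X" by simp
  fix f g assume "f \<in> im_H_transpose X" "g \<in> im_H_transpose X"
  then obtain y z where "f = transpose_mult (gfaces X 1) H_matrix y" "y \<in> coord_space (gfaces X 1)"
    "g = transpose_mult (gfaces X 1) H_matrix z" "z \<in> coord_space (gfaces X 1)"
    unfolding im_H_transpose_def by blast
  moreover from this have "y + z \<in> coord_space (gfaces X 1)"
    by (intro fspace.subspace_add [OF subspace_coord_space])
  ultimately show "f + g \<in> im_H_transpose X"
    unfolding im_H_transpose_def by (simp add: transpose_mult_add [symmetric])
qed

lemma H_matrix_in_im_H_transpose: "U \<in> gfaces X 1 \<Longrightarrow> H_matrix U \<in> im_H_transpose X"
  unfolding im_H_transpose_def
  using transpose_mult_indicator [of "gfaces X 1" U H_matrix] indicator_in_coord_space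
  by (metis finite image_eqI)

text \<open>Closure under subspaces puts the line \<open>vec.span {x}\<close>, which is
  \<open>{0, x}\<close>, into \<open>X\<close>.\<close>

lemma points_grassmannian:
  assumes "grassmannian_complex X" "U \<in> X" "x \<in> U" "x \<noteq> 0"
  shows "x \<in> points X"
proof -
  have "vec.subspace U" using assms by (simp add: grassmannian_complex_def)
  then have "vec.span {x} \<subseteq> U" using assms by (intro vec.span_minimal) auto
  then have "{0, x} \<in> X"
    using assms vec.subspace_span [of "{x}"] unfolding grassmannian_complex_def span_singleton_bit by blast
  moreover have "vec.dim {0, x} = 1"
    using vec.dim_span_eq_card_independent [of "{x}"] assms by (simp add: span_singleton_bit)
  ultimately show ?thesis using assms by (simp add: points_def gfaces_def)
qed

lemma gfaces_1_E:
  assumes "grassmannian_complex X" "U \<in> gfaces X 1"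
  obtains x y where "U = vec.span {x, y}" "x \<in> points X" "y \<in> points X" "x \<noteq> y"
proof -
  have U: "U \<in> X" "vec.dim U = 2" "vec.subspace U"
    using assms by (auto simp: gfaces_def grassmannian_complex_def)
  obtain B where B: "B \<subseteq> U" "vec.independent B" "U \<subseteq> vec.span B" "card B = 2"
    using vec.basis_exists [of U] U by metis
  then obtain x y where xy: "B = {x, y}" "x \<noteq> y" by (meson card_2_iff)
  \<comment> \<open>An independent set omits 0, so both basis vectors are points.\<close>
  have "0 \<notin> B" using B vec.dependent_zero by blast
  then have "x \<in> points X" "y \<in> points X"
    using points_grassmannian [OF assms(1) U(1)] B xy by auto
  moreover have "U = vec.span {x, y}"
    using B U xy vec.span_minimal by blast
  ultimately show ?thesis using that xy by blast
qed

lemma points_add: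
  assumes "grassmannian_complex X" "x \<in> points X" "y \<in> points X" "x \<noteq> y" "vec.span {x, y} \<in> gfaces X 1"
  shows "x + y \<in> points X"
proof (rule points_grassmannian)
  show "vec.span {x, y} \<in> X" using assms by (simp add: gfaces_def)
  show "x + y \<in> vec.span {x, y}" by (simp add: span_pair_bit)
  show "x + y \<noteq> 0" using assms by (simp add: bit_vec_add_eq_0_iff)
qed (use assms in auto)

text \<open>Each corner lies on two sides, so the endpoints cancel. The labels \<open>x\<close>,
  \<open>y\<close> and \<open>x + y\<close> are the nonzero elements of the plane, which is a row of
  \<open>H\<close>.\<close>

lemma triangle_boundary:
  assumes "grassmannian_complex X" "v \<in> cayley_vertices X" "x \<in> points X" "y \<in> points X" "x \<noteq> y"
    "vec.span {x, y} \<in> gfaces X 1"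
  shows "boundary (cayley_complex X) 2 (indicator {{v, v + x, v + y}}) \<in> cycles (cayley_complex X) 1"
    and "edge_label_map X (boundary (cayley_complex X) 2 (indicator {{v, v + x, v + y}})) =
      H_matrix (vec.span {x, y})"
proof -
  have xy: "x + y \<in> points X" using assms points_add by blast
  have vx: "v + x \<in> cayley_vertices X"
    using assms cayley_vertices_add points_subset_cayley_vertices by blast
  have eq: "boundary (cayley_complex X) 2 (indicator {{v, v + x, v + y}}) =
      cayley_edge v x + cayley_edge v y + cayley_edge (v + x) (x + y)"
    using assms boundary_triangle xy by blast
  have "cayley_edge v x + cayley_edge v y + cayley_edge (v + x) (x + y) \<in> chains (cayley_complex X) 1"
    using assms vx xy by (intro fspace.subspace_add [OF subspace_chains] cayley_edge_in_chains)
  moreover have "v + x + (x + y) = v + y" by (simp add: add.assoc)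
  ultimately show "boundary (cayley_complex X) 2 (indicator {{v, v + x, v + y}}) \<in> cycles (cayley_complex X) 1"
    unfolding eq cycles_def mem_Collect_eq boundary_add
      boundary_edge [OF assms(2,3)] boundary_edge [OF assms(2,4)] boundary_edge [OF vx xy]
    by (simp add: add_ac)
  have ne: "x \<noteq> 0" "y \<noteq> 0" "x + y \<noteq> 0" "x + y \<noteq> x" "x + y \<noteq> y"
    using assms points_nonzero by (auto simp: bit_vec_add_eq_0_iff)
  have "edge_label_map X (cayley_edge v x + cayley_edge v y + cayley_edge (v + x) (x + y)) =
      indicator {x} + indicator {y} + indicator {x + y}"
    using assms vx xy by (simp add: edge_label_map_add edge_label_map_edge)
  also have "\<dots> = H_matrix (vec.span {x, y})"
    using ne \<open>x \<noteq> y\<close> by (auto simp: H_matrix_def span_pair_bit indicator_def fun_eq_iff pointwise)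
  finally show "edge_label_map X (boundary (cayley_complex X) 2 (indicator {{v, v + x, v + y}})) =
      H_matrix (vec.span {x, y})"
    unfolding eq .
qed

lemma boundaries_labels:
  assumes "grassmannian_complex X" "b \<in> boundaries (cayley_complex X) 1"
  shows "b \<in> cycles (cayley_complex X) 1" and "edge_label_map X b \<in> im_H_transpose X"
proof -
  let ?K = "cayley_complex X"
  have "boundary ?K 2 c \<in> cycles ?K 1 \<and> edge_label_map X (boundary ?K 2 c) \<in> im_H_transpose X"
    if c: "c \<in> coord_space (simplices ?K 2)" for c
  proof -
    have "finite (simplices ?K 2)" by simp
    then show ?thesis
      using c
    proof (induction rule: coord_space_induct)
      case zero
      show ?case
        by (simp add: fspace.subspace_0 [OF subspace_cycles]
            fspace.subspace_0 [OF subspace_im_H_transpose])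
    next
      case (add c \<sigma>)
      then obtain v x y where "\<sigma> = {v, v + x, v + y}" and
        vxy: "v \<in> cayley_vertices X" "x \<in> points X" "y \<in> points X" "x \<noteq> y" "vec.span {x, y} \<in> gfaces X 1"
        unfolding triangles_cayley_complex by blast
      then have "boundary ?K 2 (indicator {\<sigma>}) \<in> cycles ?K 1"
        "edge_label_map X (boundary ?K 2 (indicator {\<sigma>})) \<in> im_H_transpose X"
        using triangle_boundary [OF assms(1) vxy] H_matrix_in_im_H_transpose [OF vxy(5)]
        by (simp_all only:)
      then show ?case
        unfolding boundary_add edge_label_map_add
        using fspace.subspace_add [OF subspace_cycles conjunct1 [OF add.IH]]
          fspace.subspace_add [OF subspace_im_H_transpose conjunct2 [OF add.IH]]
        by (intro conjI)
    qed
  qed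
  then show "b \<in> cycles ?K 1" "edge_label_map X b \<in> im_H_transpose X"
    using assms(2) unfolding boundaries_def chains_def one_add_one by blast+
qed

text \<open>A row of \<open>H\<close> is realized by the triangle at 0 whose other corners form a
  basis of the plane.\<close>

lemma im_H_transpose_labels:
  assumes "grassmannian_complex X" "y \<in> im_H_transpose X"
  shows "\<exists>b\<in>boundaries (cayley_complex X) 1. edge_label_map X b = y"
proof -
  let ?B = "boundaries (cayley_complex X) 1"
  obtain u where u: "u \<in> coord_space (gfaces X 1)" "y = transpose_mult (gfaces X 1) H_matrix u"
    using assms by (auto simp: im_H_transpose_def)
  have "finite (gfaces X 1)" by simp
  then have "\<exists>b\<in>?B. edge_label_map X b = transpose_mult (gfaces X 1) H_matrix u"
    using u(1)
  proof (induction rule: coord_space_induct)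
    case zero
    show ?case
      by (intro bexI [of _ 0] fspace.subspace_0 [OF subspace_boundaries]) simp
  next
    case (add u U)
    obtain x y where U: "U = vec.span {x, y}" and xy: "x \<in> points X" "y \<in> points X" "x \<noteq> y"
      using gfaces_1_E [OF assms(1) add.hyps(2)] by blast
    note span = add.hyps(2) [unfolded U]
    obtain b where b: "b \<in> ?B" "edge_label_map X b = transpose_mult (gfaces X 1) H_matrix u"
      using add.IH by blast
    let ?t = "boundary (cayley_complex X) 2 (indicator {{0, 0 + x, 0 + y}})"
    have "{0, 0 + x, 0 + y} \<in> simplices (cayley_complex X) 2"
      unfolding triangles_cayley_complex using xy span zero_in_cayley_vertices [of X] by blast
    then have "?t \<in> ?B"
      unfolding boundaries_def chains_def one_add_one by (intro imageI indicator_in_coord_space)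
    then have "b + ?t \<in> ?B" by (rule fspace.subspace_add [OF subspace_boundaries b(1)])
    moreover have "edge_label_map X (b + ?t) =
        transpose_mult (gfaces X 1) H_matrix (u + indicator {U})"
      unfolding edge_label_map_add transpose_mult_add b(2)
        triangle_boundary(2) [OF assms(1) zero_in_cayley_vertices xy span]
        U transpose_mult_indicator [OF finite span] ..
    ultimately show ?case by blast
  qed
  then show ?thesis using u by blast
qed

text \<open>From left to right, adding a boundary with the same labels leaves a cycle without
  labels, hence a sum of swap cycles by \<open>cycle_labels\<close>.\<close>

lemma edge_label_map_in_im_H_transpose_iff:
  assumes "grassmannian_complex X" "z \<in> cycles (cayley_complex X) 1"
  shows "edge_label_map X z \<in> im_H_transpose X \<longleftrightarrow> z \<in> swap_cycles X + boundaries (cayley_complex X) 1"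
proof
  assume "edge_label_map X z \<in> im_H_transpose X"
  then obtain b where b: "b \<in> boundaries (cayley_complex X) 1" "edge_label_map X b = edge_label_map X z"
    using im_H_transpose_labels assms(1) by blast
  then have "z + b \<in> cycles (cayley_complex X) 1"
    using fspace.subspace_add [OF subspace_cycles assms(2) boundaries_labels(1) [OF assms(1)]] by blast
  moreover have "edge_label_map X (z + b) = 0" using b by (simp add: edge_label_map_add)
  ultimately have "z + b \<in> swap_cycles X" using cycle_labels(2) by blast
  then have "(z + b) + b \<in> swap_cycles X + boundaries (cayley_complex X) 1"
    using b(1) by (rule set_plus_intro)
  then show "z \<in> swap_cycles X + boundaries (cayley_complex X) 1" by (simp add: add.assoc)
next
  assume "z \<in> swap_cycles X + boundaries (cayley_complex X) 1"
  then obtain s b where "z = s + b" "s \<in> swap_cycles X" "b \<in> boundaries (cayley_complex X) 1"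
    by (auto elim: set_plus_elim)
  then show "edge_label_map X z \<in> im_H_transpose X"
    by (simp add: edge_label_map_add edge_label_map_swap_cycles [of s X] boundaries_labels(2) [OF assms(1)])
qed

section \<open>Assembly of the two isomorphisms\<close>

lemma subspace_set_plus:
  assumes "fspace.subspace S" "fspace.subspace T"
  shows "fspace.subspace (S + T)"
proof -
  have "S + T = {x + y | x y. x \<in> S \<and> y \<in> T}" by (auto simp: set_plus_def)
  then show ?thesis using fspace.subspace_sums [OF assms] by (simp only:)
qed

theorem theorem83:
  fixes X :: "(bit ^ 'k::finite) set set"
  assumes "grassmannian_complex X" and "has_rank X 1"
  shows "(\<exists>\<phi>. linear_iso_betw
            (quotient_scale (quotient_scale fscale (boundaries (cayley_complex X) 1))
               (swap_classes X))
            (quotient_space (homology (cayley_complex X) 1)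
               (swap_classes X))
            (quotient_scale fscale (im_H_transpose X))
            (quotient_space (ker_G_transpose X) (im_H_transpose X)) \<phi> \<and>
          (\<forall>z\<in>cycles (cayley_complex X) 1.
             \<phi> ((z +o boundaries (cayley_complex X) 1) +o swap_classes X) =
               edge_label_map X z +o im_H_transpose X)) \<and>
         (\<exists>\<psi>. linear_iso_betw
            (quotient_scale fscale (swap_cycles X + boundaries (cayley_complex X) 1))
            (quotient_space (cycles (cayley_complex X) 1)
               (swap_cycles X + boundaries (cayley_complex X) 1))
            (quotient_scale fscale (im_H_transpose X))
            (quotient_space (ker_G_transpose X) (im_H_transpose X)) \<psi> \<and>
          (\<forall>z\<in>cycles (cayley_complex X) 1.
             \<psi> (z +o (swap_cycles X + boundaries (cayley_complex X) 1)) =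
               edge_label_map X z +o im_H_transpose X))"
proof -
  let ?Z = "cycles (cayley_complex X) 1" and ?B = "boundaries (cayley_complex X) 1"
  let ?S = "swap_cycles X" and ?N = "im_H_transpose X"
  let ?q = "\<lambda>z. (z +o ?B) +o swap_classes X" and ?r = "\<lambda>z. z +o (?S + ?B)"
  let ?g = "\<lambda>z. edge_label_map X z +o ?N"
  note S = subspace_swap_cycles [of X]
  note B = subspace_boundaries [of "cayley_complex X" 1]
  note N = subspace_im_H_transpose [of X]
  note SB = subspace_set_plus [OF S B]
  have Z_add: "v + w \<in> ?Z" if "v \<in> ?Z" "w \<in> ?Z" for v w
    using that fspace.subspace_add [OF subspace_cycles] by blast
  have Z_scale: "fscale c v \<in> ?Z" if "v \<in> ?Z" for c v
    using that fspace.subspace_scale [OF subspace_cycles] by blast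
  have g_add: "?g v + ?g w = ?g (v + w)" for v w
    by (simp only: fspace.quotient_operations(1) [OF N] edge_label_map_add)
  have g_scale: "quotient_scale fscale ?N c (?g v) = ?g (fscale c v)" for c v
  proof -
    have "edge_label_map X (fscale c v) = fscale c (edge_label_map X v)"
      by (cases c) (simp_all add: fscale_bit)
    then show ?thesis by (simp only: fspace.quotient_operations(2) [OF N])
  qed
  \<comment> \<open>The criterion on the right is also equality of classes in either quotient, so
    the edge labels induce both isomorphisms in the same way.\<close>
  have g_eq: "?g v = ?g w \<longleftrightarrow> v - w \<in> ?S + ?B" if "v \<in> ?Z" "w \<in> ?Z" for v w
  proof -
    have "?g v = ?g w \<longleftrightarrow> edge_label_map X (v + w) \<in> ?N"
      unfolding fspace.coset_eq_iff [OF N] by (simp only: bit_fun_diff edge_label_map_add)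
    also have "\<dots> \<longleftrightarrow> v + w \<in> ?S + ?B"
      using edge_label_map_in_im_H_transpose_iff [OF assms(1) Z_add] that by blast
    finally show ?thesis by (simp only: bit_fun_diff)
  qed
  \<comment> \<open>Surjectivity: the labels of cycles fill the kernel of the transpose of
    \<open>G\<close>.\<close>
  have ker: "?g ` ?Z = quotient_space (ker_G_transpose X) ?N"
    unfolding quotient_space_def edge_label_map_cycles [symmetric] image_image ..
  have q: "?q ` ?Z = quotient_space (homology (cayley_complex X) 1) (swap_classes X)"
    unfolding quotient_space_def homology_def image_image ..
  have r: "?r ` ?Z = quotient_space ?Z (?S + ?B)"
    unfolding quotient_space_def ..
  have "\<exists>\<phi>. linear_iso_betw (quotient_scale (quotient_scale fscale ?B) (swap_classes X)) (?q ` ?Z)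
      (quotient_scale fscale ?N) (?g ` ?Z) \<phi> \<and> (\<forall>z\<in>?Z. \<phi> (?q z) = ?g z)"
  proof (rule linear_iso_betw_induced [where s = fscale])
    show "?q v + ?q w = ?q (v + w)" for v w
      unfolding swap_classes_def by (rule fspace.iterated_coset_add [OF S B])
    show "quotient_scale (quotient_scale fscale ?B) (swap_classes X) c (?q v) = ?q (fscale c v)" for c v
      unfolding swap_classes_def by (rule fspace.iterated_coset_scale [OF S B])
    show "?q v = ?q w \<longleftrightarrow> ?g v = ?g w" if "v \<in> ?Z" "w \<in> ?Z" for v w
      unfolding swap_classes_def g_eq [OF that] by (rule fspace.iterated_coset_eq_iff [OF S B])
  qed (use Z_add Z_scale g_add g_scale in blast)+
  moreover have "\<exists>\<psi>. linear_iso_betw (quotient_scale fscale (?S + ?B)) (?r ` ?Z)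
      (quotient_scale fscale ?N) (?g ` ?Z) \<psi> \<and> (\<forall>z\<in>?Z. \<psi> (?r z) = ?g z)"
  proof (rule linear_iso_betw_induced [where s = fscale])
    show "?r v + ?r w = ?r (v + w)" for v w
      by (rule fspace.quotient_operations(1) [OF SB])
    show "quotient_scale fscale (?S + ?B) c (?r v) = ?r (fscale c v)" for c v
      by (rule fspace.quotient_operations(2) [OF SB])
    show "?r v = ?r w \<longleftrightarrow> ?g v = ?g w" if "v \<in> ?Z" "w \<in> ?Z" for v w
      unfolding g_eq [OF that] by (rule fspace.coset_eq_iff [OF SB])
  qed (use Z_add Z_scale g_add g_scale in blast)+
  ultimately show ?thesis unfolding ker q r by blast
qed

end
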